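(* Let $X$ be a directed metric space. Then the Hirai–Koichi directed tight span $\mathcal{E}_{\mathrm{HK}}(X)$ can be given two canonical semi-tropical module structures: one making it a co-metric semi-tropical module and one making it a metric semi-tropical module.
   Context: A directed metric space is a set $X$ with $d\colon X\times X\to[0,\infty)$ satisfying the axioms of a metric except symmetry: $d(x,y)=0$ iff $x=y$, and $d(x,y)+d(y,z)\ge d(x,z)$. For $a,b\in[0,\infty]$ write $b\dot{-}a:=\max(b-a,0)$ (with $\infty\dot{-}\infty=0$). A pair $(f,g)$ of functions $f,g\colon X\to[0,\infty]$ is triangular if $f(x)+g(y)\ge d(x,y)$ for all $x,y\in X$; it is minimal if every triangular pair $(f',g')$ with $f'(x)\le f(x)$ and $g'(y)\le g(y)$ for all $x,y\in X$ equals $(f,g)$. The directed tight span $\mathcal{E}_{\mathrm{HK}}(X)$ is the set of minimal triangular pairs, with the generalized metric $d((f,g),(f',g'))=\sup_{x\in X}\max(f'(x)\dot{-}f(x),\,g(x)\dot{-}g'(x))$. (A generalized metric on a set $M$ is a function $d\colon M\times M\to[0,\infty]$ with $d(m,m)=0$ and the triangle inequality, symmetry not required.) The semi-tropical semiring is $([0,\infty],\min,+)$: addition is $\min$ (unit $\infty$), multiplication is $+$ (unit $0$). A semi-tropical module is a commutative monoid $(M,\oplus,\mathbf 0)$ with an action $\odot\colon[0,\infty]\times M\to M$ such that $r\mapsto r\odot(-)$ is a unital semiring morphism to the semiring $(\operatorname{End}(M),\oplus,\circ)$ of monoid endomorphisms of $M$ (preserving addition, multiplication and both units). Morphisms are monoid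 maps preserving the action. The monoid $([0,\infty],\max)$ is a semi-tropical module via $r\odot m:=m\dot{-}r$. A semi-tropical module structure on a set $M$ with generalized metric $d$ is co-metric if for every $x\in M$ the map $d(-,x)\colon M\to([0,\infty],\max)$ is a morphism of semi-tropical modules, and metric if for every $x\in M$ the map $d(x,-)\colon M\to([0,\infty],\max)$ is a morphism of semi-tropical modules. *)

theory Defs
  imports "HOL-Library.Extended_Nonnegative_Real" "HOL-Algebra.Ring"
begin

section \<open>Directed metric spaces and generalized metrics\<close>

locale directed_metric_space =
  fixes X :: "'a set" and d :: "'a \<Rightarrow> 'a \<Rightarrow> real"
  assumes nonneg: "\<lbrakk>x \<in> X; y \<in> X\<rbrakk> \<Longrightarrow> 0 \<le> d x y"
    and eq_0_iff: "\<lbrakk>x \<in> X; y \<in> X\<rbrakk> \<Longrightarrow> d x y = 0 \<longleftrightarrow> x = y"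
    and triangle: "\<lbrakk>x \<in> X; y \<in> X; z \<in> X\<rbrakk> \<Longrightarrow> d x z \<le> d x y + d y z"

locale generalized_metric_space =
  fixes M :: "'m set" and d :: "'m \<Rightarrow> 'm \<Rightarrow> ennreal"
  assumes refl_0: "x \<in> M \<Longrightarrow> d x x = 0"
    and triangle: "\<lbrakk>x \<in> M; y \<in> M; z \<in> M\<rbrakk> \<Longrightarrow> d x z \<le> d x y + d y z"

text \<open>The subtraction of \<^typ>\<open>ennreal\<close> is already truncated at 0, but it satisfies \<^prop>\<open>\<infinity> - \<infinity> = (\<infinity> :: ennreal)\<close>.\<close>

definition monus :: "ennreal \<Rightarrow> ennreal \<Rightarrow> ennreal"  (infixl "\<ominus>\<^sub>t" 65)
  where "b \<ominus>\<^sub>t a = (if b = \<infinity> \<and> a = \<infinity> then 0 else b - a)"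


section \<open>The directed tight span\<close>

text \<open>Functions on \<open>X\<close> are total functions that are \<^const>\<open>extensional\<close> on \<open>X\<close>, so that equality of
  pairs means equality on \<open>X\<close>.\<close>

definition triangular_pairs ::
    "'a set \<Rightarrow> ('a \<Rightarrow> 'a \<Rightarrow> real) \<Rightarrow> (('a \<Rightarrow> ennreal) \<times> ('a \<Rightarrow> ennreal)) set"
  where "triangular_pairs X d =
    {(f, g). f \<in> extensional X \<and> g \<in> extensional X \<and>
             (\<forall>x\<in>X. \<forall>y\<in>X. ennreal (d x y) \<le> f x + g y)}"

definition directed_tight_span ::
    "'a set \<Rightarrow> ('a \<Rightarrow> 'a \<Rightarrow> real) \<Rightarrow> (('a \<Rightarrow> ennreal) \<times> ('a \<Rightarrow> ennreal)) set"
  where "directed_tight_span X d =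
    {(f, g). (f, g) \<in> triangular_pairs X d \<and>
             (\<forall>f' g'. (f', g') \<in> triangular_pairs X d \<and> (\<forall>x\<in>X. f' x \<le> f x) \<and> (\<forall>y\<in>X. g' y \<le> g y)
                \<longrightarrow> (f', g') = (f, g))}"

definition tight_span_dist ::
    "'a set \<Rightarrow> ('a \<Rightarrow> ennreal) \<times> ('a \<Rightarrow> ennreal) \<Rightarrow> ('a \<Rightarrow> ennreal) \<times> ('a \<Rightarrow> ennreal) \<Rightarrow> ennreal"
  where "tight_span_dist X = (\<lambda>(f, g) (f', g').
    SUP x\<in>X. max (f' x \<ominus>\<^sub>t f x) (g x \<ominus>\<^sub>t g' x))"


section \<open>Semi-tropical modules\<close>

definition semi_tropical_semiring :: "ennreal ring"
  where "semi_tropical_semiring =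
    \<lparr>carrier = UNIV, monoid.mult = (+), one = 0, zero = \<infinity>, add = min\<rparr>"

text \<open>The underlying commutative monoid of a semi-tropical module is written with the
  (multiplicative) syntax of HOL-Algebra: its operation is \<open>\<otimes>\<close> and its unit is \<open>\<one>\<close>.\<close>

record 'm semi_tropical_struct = "'m monoid" +
  act :: "ennreal \<Rightarrow> 'm \<Rightarrow> 'm"  (infixr "\<odot>\<index>" 75)

definition End_semiring :: "('m, 'b) monoid_scheme \<Rightarrow> ('m \<Rightarrow> 'm) ring"
  where "End_semiring M =
    \<lparr>carrier = {\<phi> \<in> extensional (carrier M). \<phi> \<in> hom M M \<and> \<phi> \<one>\<^bsub>M\<^esub> = \<one>\<^bsub>M\<^esub>},
     monoid.mult = compose (carrier M),
     one = (\<lambda>m\<in>carrier M. m),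
     zero = (\<lambda>m\<in>carrier M. \<one>\<^bsub>M\<^esub>),
     add = (\<lambda>\<phi> \<psi>. \<lambda>m\<in>carrier M. \<phi> m \<otimes>\<^bsub>M\<^esub> \<psi> m)\<rparr>"

text \<open>\<^const>\<open>ring_hom\<close> does not include the preservation of zero, which is not automatic
  for semirings.\<close>

locale semi_tropical_module = comm_monoid M for M (structure) +
  assumes act_ring_hom:
      "(\<lambda>r. \<lambda>m\<in>carrier M. r \<odot> m) \<in> ring_hom semi_tropical_semiring (End_semiring M)"
    and act_zero:
      "(\<lambda>m\<in>carrier M. \<zero>\<^bsub>semi_tropical_semiring\<^esub> \<odot> m) = \<zero>\<^bsub>End_semiring M\<^esub>"

definition semi_tropical_hom ::
    "('m, 'b) semi_tropical_struct_scheme \<Rightarrow> ('n, 'c) semi_tropical_struct_scheme \<Rightarrow> ('m \<Rightarrow> 'n) set"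
  where "semi_tropical_hom M N =
    {h \<in> hom M N. h \<one>\<^bsub>M\<^esub> = \<one>\<^bsub>N\<^esub> \<and> (\<forall>r. \<forall>m\<in>carrier M. h (r \<odot>\<^bsub>M\<^esub> m) = r \<odot>\<^bsub>N\<^esub> h m)}"

definition max_module :: "ennreal semi_tropical_struct"
  where "max_module =
    \<lparr>carrier = UNIV, monoid.mult = max, one = 0, act = (\<lambda>r m. m \<ominus>\<^sub>t r)\<rparr>"

locale co_metric_module =
  semi_tropical_module M + generalized_metric_space "carrier M" d
  for M (structure) and d +
  assumes dist_to_hom: "x \<in> carrier M \<Longrightarrow> (\<lambda>m. d m x) \<in> semi_tropical_hom M max_module"

locale metric_module =
  semi_tropical_module M + generalized_metric_space "carrier M" d
  for M (structure) and d +
  assumes dist_from_hom: "x \<in> carrier M \<Longrightarrow> (\<lambda>m. d x m) \<in> semi_tropical_hom M max_module"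

text \<open>The operations of a structure are total functions; only their values on the carrier matter.\<close>

definition same_structure ::
    "'m semi_tropical_struct \<Rightarrow> 'm semi_tropical_struct \<Rightarrow> bool"
  where "same_structure M N \<longleftrightarrow>
    carrier M = carrier N \<and> \<one>\<^bsub>M\<^esub> = \<one>\<^bsub>N\<^esub> \<and>
    (\<forall>m\<in>carrier M. \<forall>n\<in>carrier M. m \<otimes>\<^bsub>M\<^esub> n = m \<otimes>\<^bsub>N\<^esub> n) \<and>
    (\<forall>r. \<forall>m\<in>carrier M. r \<odot>\<^bsub>M\<^esub> m = r \<odot>\<^bsub>N\<^esub> m)"

end

theory Submission
  imports Defs
begin

text \<open>
  A point \<open>p\<close> of a separated generalized metric space \<open>(M, D)\<close> is determined by the function
  \<open>D(-, p)\<close> (Yoneda). A metric module structure prescribes these functions for its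
  results: \<open>D(x, \<one>) = 0\<close>, \<open>D(x, m \<otimes> n) = max (D(x, m)) (D(x, n))\<close> and
  \<open>D(x, r \<odot> m) = D(x, m) \<ominus>\<^sub>t r\<close>. Hence there is at most one such structure, and there is one as soon
  as the prescribed functions are of the form \<open>D(-, p)\<close>: the module axioms then hold because they
  hold in \<open>([0,\<infinity>], max)\<close>. This is what the locale \<open>max_representable\<close> expresses.

  For the tight span, \<open>(f, g)\<close> is minimal if and only if \<open>f\<close> and \<open>g\<close> are exchanged by the polarity
  \<open>f\<^sup>*(y) = sup\<^sub>x (d(x,y) \<ominus>\<^sub>t f(x))\<close> and its mirror image
  (\<open>mem_directed_tight_span_iff\<close>). So the first components of minimal pairs are
  exactly the mirrored polars \<open>k\<^sup>*\<close> of arbitrary functions \<open>k\<close>, and these are closed under the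
  three operations, since \<open>\<infinity>\<^sup>* = 0\<close>, \<open>(min k l)\<^sup>* = max k\<^sup>* l\<^sup>*\<close> and \<open>(k + r)\<^sup>* = k\<^sup>* \<ominus>\<^sub>t r\<close>. Moreover the
  polarity preserves distances, so that the distance from \<open>(f, g)\<close> to \<open>(f', g')\<close> is already
  \<open>sup (f' \<ominus>\<^sub>t f)\<close> (\<open>tight_span_dist_le_iff\<close>), and the operations on first components
  give the required functions. This yields the metric structure.

  Exchanging the two components identifies the tight span of \<open>d\<close> with that of the reversed metric
  and reverses the distance, which turns the metric structure of the latter into the
  co-metric structure of the former.
\<close>

section \<open>Truncated subtraction\<close>

text \<open>Truncated subtraction is left adjoint to addition. All identities between distances below are
  obtained from this adjunction by comparing upper bounds, which avoids case distinctions on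
  infinite values.\<close>

lemma monus_le_iff: "b \<ominus>\<^sub>t a \<le> c \<longleftrightarrow> b \<le> a + c"
  by (auto simp: monus_def ennreal_minus_le_iff)

lemma eq_if_same_upper_bounds: "(\<And>c. a \<le> c \<longleftrightarrow> b \<le> c) \<Longrightarrow> a = b" for a b :: ennreal
  by (meson antisym order_refl)

lemma monus_zero [simp]: "m \<ominus>\<^sub>t 0 = m"
  by (simp add: monus_def)

lemma monus_top [simp]: "m \<ominus>\<^sub>t top_class.top = 0"
  using monus_le_iff[of m top_class.top 0] by simp

lemma zero_monus [simp]: "0 \<ominus>\<^sub>t r = 0"
  using monus_le_iff[of 0 r 0] by simp

lemma monus_monus: "(m \<ominus>\<^sub>t r) \<ominus>\<^sub>t s = m \<ominus>\<^sub>t (r + s)"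
  by (rule eq_if_same_upper_bounds) (simp add: monus_le_iff add.assoc)

lemma max_monus: "max m n \<ominus>\<^sub>t r = max (m \<ominus>\<^sub>t r) (n \<ominus>\<^sub>t r)"
  by (rule eq_if_same_upper_bounds) (simp add: monus_le_iff)

lemma le_min_add_iff: "m \<le> min r s + c \<longleftrightarrow> m \<le> r + c \<and> m \<le> s + c" for m r s c :: ennreal
  using min_of_mono[of "\<lambda>x. x + c" r s] by (simp add: mono_def add_right_mono flip: min.bounded_iff)

lemma monus_min: "m \<ominus>\<^sub>t min r s = max (m \<ominus>\<^sub>t r) (m \<ominus>\<^sub>t s)"
  by (rule eq_if_same_upper_bounds) (simp add: monus_le_iff le_min_add_iff)


section \<open>Module structures determined by distances\<close>

lemma metric_module_dist:
  assumes "metric_module C D" "x \<in> carrier C"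
  shows "D x \<one>\<^bsub>C\<^esub> = 0"
    and "\<lbrakk>m \<in> carrier C; n \<in> carrier C\<rbrakk> \<Longrightarrow> D x (m \<otimes>\<^bsub>C\<^esub> n) = max (D x m) (D x n)"
    and "m \<in> carrier C \<Longrightarrow> D x (r \<odot>\<^bsub>C\<^esub> m) = D x m \<ominus>\<^sub>t r"
  using metric_module.dist_from_hom[OF assms]
  by (auto simp: semi_tropical_hom_def hom_def max_module_def)

lemma semi_tropical_module_act_closed:
  assumes "semi_tropical_module C" "m \<in> carrier C"
  shows "r \<odot>\<^bsub>C\<^esub> m \<in> carrier C"
proof -
  have "(\<lambda>m\<in>carrier C. r \<odot>\<^bsub>C\<^esub> m) \<in> carrier (End_semiring C)"
    using semi_tropical_module.act_ring_hom[OF assms(1)]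
    by (auto simp: ring_hom_def semi_tropical_semiring_def)
  then have "(\<lambda>m\<in>carrier C. r \<odot>\<^bsub>C\<^esub> m) \<in> carrier C \<rightarrow> carrier C"
    by (simp add: End_semiring_def hom_def)
  from funcset_mem[OF this assms(2)] show ?thesis
    using assms(2) by simp
qed

text \<open>The functions \<open>D(-, p)\<close> are required to form a submodule of the module of all functions
  from \<open>M\<close> to \<open>([0,\<infinity>], max)\<close>.\<close>

locale max_representable = generalized_metric_space M D for M :: "'m set" and D +
  assumes separated: "\<lbrakk>p \<in> M; q \<in> M; D p q = 0; D q p = 0\<rbrakk> \<Longrightarrow> p = q"
    and unit_ex: "\<exists>u\<in>M. \<forall>x\<in>M. D x u = 0"
    and join_ex: "\<lbrakk>m \<in> M; n \<in> M\<rbrakk> \<Longrightarrow> \<exists>p\<in>M. \<forall>x\<in>M. D x p = max (D x m) (D x n)"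
    and act_ex: "m \<in> M \<Longrightarrow> \<exists>p\<in>M. \<forall>x\<in>M. D x p = D x m \<ominus>\<^sub>t r"
begin

lemma yoneda:
  assumes "p \<in> M" "q \<in> M" "\<And>x. x \<in> M \<Longrightarrow> D x p = D x q"
  shows "p = q"
  using assms refl_0 separated by metis

lemma metric_module_unique:
  assumes C: "metric_module C D" "carrier C = M" and C': "metric_module C' D" "carrier C' = M"
  shows "same_structure C' C"
proof -
  interpret C: metric_module C D by fact
  interpret C': metric_module C' D by fact
  note dist = metric_module_dist[OF C(1), unfolded C(2)] metric_module_dist[OF C'(1), unfolded C'(2)]
  have act: "r \<odot>\<^bsub>C\<^esub> m \<in> M" "r \<odot>\<^bsub>C'\<^esub> m \<in> M" if "m \<in> M" for r m
    using that C(2) C'(2) semi_tropical_module_act_closed[OF C.semi_tropical_module_axioms]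
      semi_tropical_module_act_closed[OF C'.semi_tropical_module_axioms] by auto
  have "\<one>\<^bsub>C'\<^esub> = \<one>\<^bsub>C\<^esub>"
    by (rule yoneda) (use C(2) C'(2) dist in auto)
  moreover have "m \<otimes>\<^bsub>C'\<^esub> n = m \<otimes>\<^bsub>C\<^esub> n" if "m \<in> M" "n \<in> M" for m n
    by (rule yoneda) (use that C(2) C'(2) C.m_closed C'.m_closed dist in auto)
  moreover have "r \<odot>\<^bsub>C'\<^esub> m = r \<odot>\<^bsub>C\<^esub> m" if "m \<in> M" for r m
    by (rule yoneda) (use that act dist in auto)
  ultimately show ?thesis
    using C(2) C'(2) by (simp add: same_structure_def)
qed

lemma metric_module_ex: "\<exists>C :: 'm semi_tropical_struct. carrier C = M \<and> metric_module C D"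
proof -
  obtain u where u: "u \<in> M" "\<And>x. x \<in> M \<Longrightarrow> D x u = 0"
    using unit_ex by blast
  obtain j where j: "\<And>m n. \<lbrakk>m \<in> M; n \<in> M\<rbrakk> \<Longrightarrow> j m n \<in> M"
      "\<And>m n x. \<lbrakk>m \<in> M; n \<in> M; x \<in> M\<rbrakk> \<Longrightarrow> D x (j m n) = max (D x m) (D x n)"
    using join_ex by metis
  define a where "a r m = (SOME p. p \<in> M \<and> (\<forall>x\<in>M. D x p = D x m \<ominus>\<^sub>t r))" for r m
  have "a r m \<in> M \<and> (\<forall>x\<in>M. D x (a r m) = D x m \<ominus>\<^sub>t r)" if "m \<in> M" for r m
    unfolding a_def by (rule someI_ex) (use act_ex[OF that] in blast)
  then have a: "\<And>r m. m \<in> M \<Longrightarrow> a r m \<in> M"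
      "\<And>r m x. \<lbrakk>m \<in> M; x \<in> M\<rbrakk> \<Longrightarrow> D x (a r m) = D x m \<ominus>\<^sub>t r"
    by blast+
  note dist = u(2) j(2) a(2) and closed = u(1) j(1) a(1)
  define C where "C = \<lparr>carrier = M, monoid.mult = j, one = u, act = a\<rparr>"
  have C: "carrier C = M" "\<one>\<^bsub>C\<^esub> = u" "monoid.mult C = j" "act C = a"
    by (simp_all add: C_def)
  have comm_monoid: "comm_monoid C"
    by (rule comm_monoidI; unfold C; (rule yoneda)?)
       (simp_all add: dist closed ac_simps)
  have endo_unit: "a r u = u" for r
    by (rule yoneda) (simp_all add: dist closed)
  have endo_join: "a r (j m n) = j (a r m) (a r n)" if "m \<in> M" "n \<in> M" for r m n
    by (rule yoneda) (use that in \<open>simp_all add: dist closed max_monus\<close>)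
  have action: "a (r + s) m = a r (a s m)" "a (min r s) m = j (a r m) (a s m)"
      "a 0 m = m" "a top_class.top m = u" if "m \<in> M" for r s m
    by (rule yoneda;
        use that in \<open>simp add: dist closed monus_monus monus_min add.commute\<close>)+
  have "(\<lambda>r. \<lambda>m\<in>carrier C. r \<odot>\<^bsub>C\<^esub> m) \<in> ring_hom semi_tropical_semiring (End_semiring C)"
    by (auto simp: C ring_hom_def semi_tropical_semiring_def End_semiring_def hom_def compose_def
        closed endo_unit endo_join action intro!: restrict_ext)
  moreover have "(\<lambda>m\<in>carrier C. \<zero>\<^bsub>semi_tropical_semiring\<^esub> \<odot>\<^bsub>C\<^esub> m) = \<zero>\<^bsub>End_semiring C\<^esub>"
    by (auto simp: C semi_tropical_semiring_def End_semiring_def action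
        intro!: restrict_ext)
  ultimately have "semi_tropical_module C"
    using comm_monoid by (simp add: semi_tropical_module_def semi_tropical_module_axioms_def)
  moreover have "(\<lambda>m. D x m) \<in> semi_tropical_hom C max_module" if "x \<in> M" for x
    using that by (auto simp: C semi_tropical_hom_def max_module_def hom_def dist)
  ultimately have "metric_module C D"
    using generalized_metric_space_axioms
    by (simp add: metric_module_def metric_module_axioms_def C)
  then show ?thesis
    using C(1) by blast
qed

theorem ex_unique_metric_module:
  "\<exists>C. carrier C = M \<and> metric_module C D \<and>
     (\<forall>C'. carrier C' = M \<and> metric_module C' D \<longrightarrow> same_structure C' C)"
proof -
  obtain C :: "'m semi_tropical_struct" where C: "carrier C = M" "metric_module C D"
    using metric_module_ex by blast
  show ?thesis
    using metric_module_unique[OF C(2,1)] C by (intro exI[of _ C]) simp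
qed

end

lemma generalized_metric_space_reverse:
  assumes "generalized_metric_space M D"
  shows "generalized_metric_space M (\<lambda>p q. D q p)"
proof -
  interpret generalized_metric_space M D by fact
  show ?thesis
    by unfold_locales (simp add: refl_0, subst add.commute, rule triangle)
qed

lemma co_metric_module_iff: "co_metric_module C D \<longleftrightarrow> metric_module C (\<lambda>p q. D q p)"
proof -
  have "generalized_metric_space (carrier C) (\<lambda>p q. D q p) \<longleftrightarrow> generalized_metric_space (carrier C) D"
    using generalized_metric_space_reverse[of "carrier C" D]
      generalized_metric_space_reverse[of "carrier C" "\<lambda>p q. D q p"] by auto
  then show ?thesis
    by (simp add: co_metric_module_def metric_module_def co_metric_module_axioms_def
        metric_module_axioms_def)
qed

lemma max_representable_isometric_image:
  assumes "max_representable M D"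
    and isometry: "\<And>p q. \<lbrakk>p \<in> M; q \<in> M\<rbrakk> \<Longrightarrow> D' (h p) (h q) = D p q"
  shows "max_representable (h ` M) D'"
proof -
  interpret max_representable M D by fact
  show ?thesis
    by unfold_locales
       (auto simp: isometry refl_0 triangle unit_ex join_ex act_ex dest: separated)
qed


section \<open>Polarity and minimal pairs\<close>

definition polar :: "'a set \<Rightarrow> ('a \<Rightarrow> 'a \<Rightarrow> real) \<Rightarrow> ('a \<Rightarrow> ennreal) \<Rightarrow> 'a \<Rightarrow> ennreal"
  where "polar X d f = (\<lambda>y\<in>X. SUP x\<in>X. ennreal (d x y) \<ominus>\<^sub>t f x)"

lemma polar_extensional [simp]: "polar X d f \<in> extensional X"
  by (simp add: polar_def)

lemma polar_le_iff:
  "y \<in> X \<Longrightarrow> polar X d f y \<le> c \<longleftrightarrow> (\<forall>x\<in>X. ennreal (d x y) \<le> f x + c)"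
  by (simp add: polar_def SUP_le_iff monus_le_iff)

lemma le_add_polar: "\<lbrakk>x \<in> X; y \<in> X\<rbrakk> \<Longrightarrow> ennreal (d x y) \<le> f x + polar X d f y"
  using polar_le_iff[of y X d f "polar X d f y"] by simp

text \<open>The polar of \<open>f\<close> is the least partner of \<open>f\<close> in a triangular pair, so minimality means that
  each component is the least partner of the other.\<close>

lemma mem_directed_tight_span_iff:
  "(f, g) \<in> directed_tight_span X d \<longleftrightarrow> f = polar X (\<lambda>x y. d y x) g \<and> g = polar X d f"
  (is "_ \<longleftrightarrow> f = ?L g \<and> g = ?R f")
proof
  assume min: "(f, g) \<in> directed_tight_span X d"
  then have tri: "f \<in> extensional X" "g \<in> extensional X"
      "\<And>x y. \<lbrakk>x \<in> X; y \<in> X\<rbrakk> \<Longrightarrow> ennreal (d x y) \<le> f x + g y"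
    by (auto simp: directed_tight_span_def triangular_pairs_def)
  have least: "(f', g') = (f, g)"
    if "(f', g') \<in> triangular_pairs X d" "\<forall>x\<in>X. f' x \<le> f x" "\<forall>y\<in>X. g' y \<le> g y" for f' g'
    using min that by (auto simp: directed_tight_span_def)
  have "(f, ?R f) = (f, g)"
    by (rule least) (auto simp: triangular_pairs_def tri le_add_polar polar_le_iff)
  moreover have "(?L g, g) = (f, g)"
    using le_add_polar[of _ X _ "\<lambda>x y. d y x" g]
    by (intro least) (auto simp: triangular_pairs_def tri polar_le_iff add.commute)
  ultimately show "f = ?L g \<and> g = ?R f"
    by simp
next
  assume fg: "f = ?L g \<and> g = ?R f"
  then have ext: "f \<in> extensional X" "g \<in> extensional X"
    by (metis polar_extensional)+
  have tri: "ennreal (d x y) \<le> f x + g y" if "x \<in> X" "y \<in> X" for x y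
    using that fg le_add_polar by metis
  have "(f', g') = (f, g)"
    if tri': "(f', g') \<in> triangular_pairs X d"
      and le: "\<forall>x\<in>X. f' x \<le> f x" "\<forall>y\<in>X. g' y \<le> g y" for f' g'
  proof -
    have d: "ennreal (d x y) \<le> f x + g' y" "ennreal (d x y) \<le> f' x + g y" if "x \<in> X" "y \<in> X" for x y
    proof -
      have "ennreal (d x y) \<le> f' x + g' y" "f' x \<le> f x" "g' y \<le> g y"
        using that tri' le by (auto simp: triangular_pairs_def)
      then show "ennreal (d x y) \<le> f x + g' y" "ennreal (d x y) \<le> f' x + g y"
        by (meson add_left_mono add_right_mono order_trans)+
    qed
    have "?R f y \<le> g' y" "?L g y \<le> f' y" if "y \<in> X" for y
      using that d by (simp_all add: polar_le_iff add.commute)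
    then have "f' x = f x" "g' x = g x" if "x \<in> X" for x
      using that fg le by (metis antisym)+
    then show ?thesis
      using tri' ext by (auto simp: triangular_pairs_def intro: extensionalityI)
  qed
  then show "(f, g) \<in> directed_tight_span X d"
    using ext tri by (auto simp: directed_tight_span_def triangular_pairs_def)
qed

text \<open>The polarity turns the bound \<open>f' \<le> f + r\<close> into \<open>f\<^sup>* \<le> f'\<^sup>* + r\<close>, so the second components
  do not contribute to the distance.\<close>

lemma tight_span_dist_le_iff:
  assumes p: "p \<in> directed_tight_span X d" and q: "q \<in> directed_tight_span X d"
  shows "tight_span_dist X p q \<le> r \<longleftrightarrow> (\<forall>x\<in>X. fst q x \<le> fst p x + r)"
proof -
  obtain f g f' g' where [simp]: "p = (f, g)" "q = (f', g')"
    by fastforce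
  have g: "g = polar X d f" and g': "g' = polar X d f'"
    using p q unfolding \<open>p = (f, g)\<close> \<open>q = (f', g')\<close> mem_directed_tight_span_iff by blast+
  have "g y \<le> g' y + r" if le: "\<forall>x\<in>X. f' x \<le> f x + r" and y: "y \<in> X" for y
    unfolding g polar_le_iff[OF y]
  proof
    fix x assume x: "x \<in> X"
    have "ennreal (d x y) \<le> f' x + g' y"
      using x y by (simp add: g' le_add_polar)
    also have "\<dots> \<le> (f x + r) + g' y"
      using le x by (intro add_right_mono) blast
    finally show "ennreal (d x y) \<le> f x + (g' y + r)"
      by (simp add: ac_simps)
  qed
  then show ?thesis
    by (auto simp: tight_span_dist_def SUP_le_iff monus_le_iff)
qed

text \<open>This is the source of new points of the tight span: a polar is already closed under the
  double polarity.\<close>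

lemma polar_in_directed_tight_span:
  fixes X d k defines "h \<equiv> polar X (\<lambda>x y. d y x) k"
  shows "(h, polar X d h) \<in> directed_tight_span X d"
proof -
  have *: "polar X d h y \<le> k y" if "y \<in> X" for y
    using that le_add_polar[of _ X _ "\<lambda>x y. d y x" k] by (simp add: h_def polar_le_iff add.commute)
  have "polar X (\<lambda>x y. d y x) (polar X d h) x = h x" if x: "x \<in> X" for x
  proof (rule antisym)
    show "polar X (\<lambda>x y. d y x) (polar X d h) x \<le> h x"
      using x le_add_polar[of x X _ d h] by (simp add: polar_le_iff add.commute)
    have "ennreal (d x y) \<le> k y + polar X (\<lambda>x y. d y x) (polar X d h) x" if "y \<in> X" for y
      using le_add_polar[OF that x, of "\<lambda>x y. d y x" "polar X d h"] *[OF that]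
      by (meson add_right_mono order_trans)
    then show "h x \<le> polar X (\<lambda>x y. d y x) (polar X d h) x"
      using x by (simp add: h_def polar_le_iff)
  qed
  then have "h = polar X (\<lambda>x y. d y x) (polar X d h)"
    by (intro extensionalityI[of _ X]) (simp_all add: h_def)
  then show ?thesis
    by (simp add: mem_directed_tight_span_iff)
qed


section \<open>The module structures on the tight span\<close>

lemma max_representable_tight_span:
  "max_representable (directed_tight_span X d) (tight_span_dist X)"
proof -
  let ?E = "directed_tight_span X d" and ?D = "tight_span_dist X"
  let ?L = "polar X (\<lambda>x y. d y x)"
  note dist_le = tight_span_dist_le_iff[where X = X and d = d]
  have closure: "\<exists>p\<in>?E. fst p = ?L k" for k
    using polar_in_directed_tight_span[of X d k] by force
  have fst_le: "fst m x \<le> c \<longleftrightarrow> (\<forall>y\<in>X. ennreal (d x y) \<le> snd m y + c)"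
    if "m \<in> ?E" "x \<in> X" for m x c
    using that mem_directed_tight_span_iff[of "fst m" "snd m" X d]
    by (metis polar_le_iff prod.collapse)
  show ?thesis
  proof
    fix p assume "p \<in> ?E"
    then show "?D p p = 0"
      using dist_le[of p p 0] by simp
  next
    fix p q s assume pqs: "p \<in> ?E" "q \<in> ?E" "s \<in> ?E"
    have "fst s x \<le> fst p x + (?D p q + ?D q s)" if x: "x \<in> X" for x
    proof -
      have "fst s x \<le> fst q x + ?D q s"
        using dist_le[OF pqs(2,3)] x by blast
      also have "\<dots> \<le> (fst p x + ?D p q) + ?D q s"
        using dist_le[OF pqs(1,2)] x by (intro add_right_mono) blast
      finally show ?thesis
        by (simp add: add.assoc)
    qed
    then show "?D p s \<le> ?D p q + ?D q s"
      using pqs by (simp add: dist_le)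
  next
    fix p q assume pq: "p \<in> ?E" "q \<in> ?E" "?D p q = 0" "?D q p = 0"
    obtain f g f' g' where [simp]: "p = (f, g)" "q = (f', g')"
      by fastforce
    have "f x = f' x" if "x \<in> X" for x
      using that pq dist_le[of p q 0] dist_le[of q p 0] by (simp add: antisym)
    then have "f = f'"
      using pq(1,2) by (auto simp: directed_tight_span_def triangular_pairs_def intro: extensionalityI)
    moreover have "g = polar X d f" "g' = polar X d f'"
      using pq(1,2) unfolding \<open>p = (f, g)\<close> \<open>q = (f', g')\<close> mem_directed_tight_span_iff by blast+
    ultimately show "p = q"
      by simp
  next
    obtain u where u: "u \<in> ?E" "fst u = ?L (\<lambda>_. \<infinity>)"
      using closure by blast
    have "fst u x \<le> 0" if "x \<in> X" for x
      unfolding u(2) polar_le_iff[OF that] by simp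
    then have "?D x u \<le> 0" if "x \<in> ?E" for x
      unfolding dist_le[OF that u(1)] by simp
    then have "?D x u = 0" if "x \<in> ?E" for x
      using that by simp
    then show "\<exists>u\<in>?E. \<forall>x\<in>?E. ?D x u = 0"
      using u(1) by blast
  next
    fix m n assume mn: "m \<in> ?E" "n \<in> ?E"
    obtain p where p: "p \<in> ?E" "fst p = ?L (\<lambda>y. min (snd m y) (snd n y))"
      using closure by blast
    have "fst p x = max (fst m x) (fst n x)" if "x \<in> X" for x
      by (rule eq_if_same_upper_bounds)
         (use that mn in \<open>auto simp: p polar_le_iff fst_le le_min_add_iff\<close>)
    then have "?D x p = max (?D x m) (?D x n)" if "x \<in> ?E" for x
      by (intro eq_if_same_upper_bounds) (use that mn p(1) in \<open>auto simp: dist_le\<close>)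
    then show "\<exists>p\<in>?E. \<forall>x\<in>?E. ?D x p = max (?D x m) (?D x n)"
      using p(1) by blast
  next
    fix m r assume m: "m \<in> ?E"
    obtain p where p: "p \<in> ?E" "fst p = ?L (\<lambda>y. snd m y + r)"
      using closure by blast
    have "fst p x = fst m x \<ominus>\<^sub>t r" if "x \<in> X" for x
      by (rule eq_if_same_upper_bounds)
         (use that m in \<open>auto simp: p polar_le_iff fst_le monus_le_iff add.assoc\<close>)
    then have "?D x p = ?D x m \<ominus>\<^sub>t r" if "x \<in> ?E" for x
      by (intro eq_if_same_upper_bounds)
         (use that m p(1) in \<open>auto simp: dist_le monus_le_iff add.left_commute\<close>)
    then show "\<exists>p\<in>?E. \<forall>x\<in>?E. ?D x p = ?D x m \<ominus>\<^sub>t r"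
      using p(1) by blast
  qed
qed

lemma directed_tight_span_swap:
  "directed_tight_span X d = prod.swap ` directed_tight_span X (\<lambda>x y. d y x)"
proof -
  have "(f, g) \<in> directed_tight_span X d \<longleftrightarrow> (g, f) \<in> directed_tight_span X (\<lambda>x y. d y x)" for f g
    unfolding mem_directed_tight_span_iff by (rule conj_commute)
  then show ?thesis
    by (force simp: image_iff)
qed

lemma tight_span_dist_swap:
  "tight_span_dist X (prod.swap q) (prod.swap p) = tight_span_dist X p q"
  by (cases p; cases q) (simp add: tight_span_dist_def max.commute)

lemma max_representable_tight_span_reverse:
  "max_representable (directed_tight_span X d) (\<lambda>p q. tight_span_dist X q p)"
proof -
  have "max_representable (prod.swap ` directed_tight_span X (\<lambda>x y. d y x))
      (\<lambda>p q. tight_span_dist X q p)"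
    using max_representable_tight_span
    by (rule max_representable_isometric_image) (rule tight_span_dist_swap)
  then show ?thesis
    by (simp only: directed_tight_span_swap[of X d])
qed

theorem mainTheorem3:
  fixes X :: "'a set" and d :: "'a \<Rightarrow> 'a \<Rightarrow> real"
  assumes "directed_metric_space X d"
  shows "(\<exists>C. carrier C = directed_tight_span X d \<and> co_metric_module C (tight_span_dist X) \<and>
            (\<forall>C'. carrier C' = directed_tight_span X d \<and> co_metric_module C' (tight_span_dist X)
               \<longrightarrow> same_structure C' C)) \<and>
         (\<exists>M. carrier M = directed_tight_span X d \<and> metric_module M (tight_span_dist X) \<and>
            (\<forall>M'. carrier M' = directed_tight_span X d \<and> metric_module M' (tight_span_dist X)
               \<longrightarrow> same_structure M' M))"
proof -
  show ?thesis
    unfolding co_metric_module_iff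
    using max_representable.ex_unique_metric_module[OF max_representable_tight_span_reverse]
      max_representable.ex_unique_metric_module[OF max_representable_tight_span]
    by (rule conjI)
qed

end
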